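(* Let $m,n$ be positive integers and let $(S,T)$ be a pair of random variables on a common probability space taking values in $\{0,1,\dots,m\}\times\{0,1,\dots,n\}$. Write $P_{[u,v]}=P(S=u,T=v)$. Then for all integers $0\le u\le m$ and $0\le v\le n$, $$P_{[u,v]}=P(S=u,T=v)=\sum_{t=u+v}^{m+n}\ \sum_{i+j=t}(-1)^{t-(u+v)}\binom{i}{u}\binom{j}{v}S_{i,j},$$ where the inner sum is over non-negative integers $i,j$ with $i+j=t$, and $S_{i,j}=E\left[\binom{S}{i}\binom{T}{j}\right]$.
   Context: For non-negative integers $a,r$, $\binom{a}{r}$ is the usual binomial coefficient, with $\binom{a}{0}=1$ and $\binom{a}{r}=0$ if $r>a$. In particular $S_{i,j}=E\left[\binom{S}{i}\binom{T}{j}\right]$ is zero if $i>m$ or $j>n$. $E$ denotes expectation. *)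

theory Defs
  imports "HOL-Probability.Probability"
begin

definition binomial_moment ::
  "'a measure \<Rightarrow> ('a \<Rightarrow> nat) \<Rightarrow> ('a \<Rightarrow> nat) \<Rightarrow> nat \<Rightarrow> nat \<Rightarrow> real" where
  "binomial_moment M S T i j =
     (\<integral>\<omega>. real (S \<omega> choose i) * real (T \<omega> choose j) \<partial>M)"

end

theory Submission
  imports Defs
begin

text \<open>
  For \<open>s \<le> m\<close>, the binomial coefficients satisfy the orthogonality relation
  \<open>\<Sum>i\<le>m. (-1)\<^sup>i\<^sup>+\<^sup>u (i choose u) (s choose i) = [s = u]\<close>. Multiplying the relation for
  \<open>s = S \<omega>\<close> and its analogue for \<open>T \<omega>\<close> and \<open>v\<close> writes the indicator of
  the event as a finite sum, and taking expectations gives the formula, since every term outside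
  the rectangle \<open>u \<le> i \<le> m\<close>, \<open>v \<le> j \<le> n\<close> vanishes.
\<close>

text \<open>The identity \<open>choose_mult\<close> pulls the factor \<open>s choose u\<close> out
  of every term. What remains is the alternating sum of row \<open>s - u\<close> of Pascal's
  triangle, which vanishes unless that row is row 0.\<close>

lemma sum_choose_orthogonal:
  fixes s m u :: nat
  assumes "s \<le> m"
  shows "(\<Sum>i\<le>m. (-1) ^ (i + u) * real (i choose u) * real (s choose i)) = (if s = u then 1 else 0)"
    (is "(\<Sum>i\<le>m. ?f i) = _")
proof (cases "u \<le> s")
  case False
  \<comment> \<open>If \<open>i < u\<close>, then \<open>i choose u\<close> vanishes; otherwise
    \<open>s < u \<le> i\<close> and \<open>s choose i\<close> vanishes.\<close>
  then have "?f i = 0" for i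
    by (cases "i < u") auto
  then have "(\<Sum>i\<le>m. ?f i) = 0"
    by (rule sum.neutral[OF ballI])
  with False show ?thesis by simp
next
  case True
  have "(\<Sum>i\<le>m. ?f i) = (\<Sum>i\<in>{u..s}. ?f i)"
    using assms by (intro sum.mono_neutral_right) (auto simp: not_le)
  also have "\<dots> = (\<Sum>k\<le>s - u. ?f (k + u))"
    using True by (intro sum.reindex_bij_witness[where i = "\<lambda>k. k + u" and j = "\<lambda>i. i - u"]) auto
  also have "\<dots> = (\<Sum>k\<le>s - u. real (s choose u) * ((-1) ^ k * real ((s - u) choose k)))"
  proof (rule sum.cong[OF refl])
    fix k assume "k \<in> {..s - u}"
    then have "(s choose (k + u)) * ((k + u) choose u) = (s choose u) * ((s - u) choose k)"
      using True choose_mult[of u "k + u" s] by simp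
    then have "real (s choose (k + u)) * real ((k + u) choose u)
        = real (s choose u) * real ((s - u) choose k)"
      by (metis of_nat_mult)
    then show "?f (k + u) = real (s choose u) * ((-1) ^ k * real ((s - u) choose k))"
      \<comment> \<open>The sign \<open>(-1) ^ (k + u + u)\<close> reduces to
        \<open>(-1) ^ k\<close>.\<close>
      by (simp add: power_add algebra_simps flip: power_mult_distrib)
  qed
  also have "\<dots> = real (s choose u) * (\<Sum>k\<le>s - u. (-1) ^ k * real ((s - u) choose k))"
    by (simp add: sum_distrib_left)
  also have "\<dots> = (if s = u then 1 else 0)"
    using True choose_alternating_sum[of "s - u", where 'a = real] by auto
  finally show ?thesis .
qed

lemma (in prob_space) integrable_choose_mult_choose:
  fixes S T :: "'a \<Rightarrow> nat"
  assumes [measurable]: "S \<in> measurable M (count_space UNIV)" "T \<in> measurable M (count_space UNIV)"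
    and bounds: "\<And>\<omega>. \<omega> \<in> space M \<Longrightarrow> S \<omega> \<le> m" "\<And>\<omega>. \<omega> \<in> space M \<Longrightarrow> T \<omega> \<le> n"
  shows "integrable M (\<lambda>\<omega>. real (S \<omega> choose i) * real (T \<omega> choose j))"
proof (rule integrable_const_bound[where B = "real (m choose i) * real (n choose j)"])
  show "AE \<omega> in M. norm (real (S \<omega> choose i) * real (T \<omega> choose j))
      \<le> real (m choose i) * real (n choose j)"
    using bounds by (intro AE_I2) (auto simp: binomial_right_mono intro!: mult_mono)
qed measurable

text \<open>The two signs stay separate so that the double sum factors into one orthogonality sum
  for \<open>S\<close> and one for \<open>T\<close>.\<close>

lemma (in prob_space) prob_eq_sum_binomial_moment:
  fixes S T :: "'a \<Rightarrow> nat"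
  assumes meas [measurable]:
    "S \<in> measurable M (count_space UNIV)" "T \<in> measurable M (count_space UNIV)"
    and bounds: "\<And>\<omega>. \<omega> \<in> space M \<Longrightarrow> S \<omega> \<le> m" "\<And>\<omega>. \<omega> \<in> space M \<Longrightarrow> T \<omega> \<le> n"
  shows "\<P>(\<omega> in M. S \<omega> = u \<and> T \<omega> = v) =
    (\<Sum>i\<le>m. \<Sum>j\<le>n. (-1) ^ (i + u) * (-1) ^ (j + v) * real (i choose u) * real (j choose v) *
       binomial_moment M S T i j)"
proof -
  let ?c = "\<lambda>i j. (-1) ^ (i + u) * (-1) ^ (j + v) * real (i choose u) * real (j choose v)"
  let ?b = "\<lambda>i j \<omega>. real (S \<omega> choose i) * real (T \<omega> choose j)"
  have int: "integrable M (?b i j)" for i j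
    using meas bounds by (rule integrable_choose_mult_choose)
  have "\<P>(\<omega> in M. S \<omega> = u \<and> T \<omega> = v) = (\<integral>\<omega>. indicator {\<omega> \<in> space M. S \<omega> = u \<and> T \<omega> = v} \<omega> \<partial>M)"
    by simp
  also have "\<dots> = (\<integral>\<omega>. (\<Sum>i\<le>m. \<Sum>j\<le>n. ?c i j * ?b i j \<omega>) \<partial>M)"
  proof (rule Bochner_Integration.integral_cong[OF refl])
    fix \<omega> assume \<omega>: "\<omega> \<in> space M"
    have "(\<Sum>i\<le>m. \<Sum>j\<le>n. ?c i j * ?b i j \<omega>) =
        (\<Sum>i\<le>m. (-1) ^ (i + u) * real (i choose u) * real (S \<omega> choose i)) *
        (\<Sum>j\<le>n. (-1) ^ (j + v) * real (j choose v) * real (T \<omega> choose j))"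
      unfolding sum_product by (intro sum.cong refl) (simp only: mult_ac)
    then show "indicator {\<omega> \<in> space M. S \<omega> = u \<and> T \<omega> = v} \<omega> = (\<Sum>i\<le>m. \<Sum>j\<le>n. ?c i j * ?b i j \<omega>)"
      using bounds[OF \<omega>] \<omega> by (simp add: sum_choose_orthogonal)
  qed
  also have "\<dots> = (\<Sum>i\<le>m. \<Sum>j\<le>n. ?c i j * (\<integral>\<omega>. ?b i j \<omega> \<partial>M))"
    using int by (simp add: Bochner_Integration.integral_sum)
  finally show ?thesis
    unfolding binomial_moment_def .
qed

text \<open>Both sums reduce to the rectangle \<open>{u..m} \<times> {v..n}\<close>, which supports
  \<open>f\<close>: its points satisfy \<open>u + v \<le> i + j \<le> m + n\<close>, so the disjoint
  antidiagonals cover it.\<close>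

lemma sum_antidiagonals:
  fixes f :: "nat \<Rightarrow> nat \<Rightarrow> 'b::comm_monoid_add"
  assumes zero: "\<And>i j. \<not> (u \<le> i \<and> i \<le> m \<and> v \<le> j \<and> j \<le> n) \<Longrightarrow> f i j = 0"
  shows "(\<Sum>t = u + v..m + n. \<Sum>(i, j) \<in> {(i, j). i + j = t}. f i j) = (\<Sum>i\<le>m. \<Sum>j\<le>n. f i j)"
proof -
  let ?D = "\<lambda>t. {(i, j). i + j = (t::nat)}"
  have fin: "finite (?D t)" for t
    by (rule finite_subset[of _ "{..t} \<times> {..t}"]) auto
  have "(\<Sum>t = u + v..m + n. \<Sum>(i, j) \<in> ?D t. f i j) = (\<Sum>(i, j) \<in> (\<Union>t\<in>{u + v..m + n}. ?D t). f i j)"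
    by (rule sum.UNION_disjoint[symmetric]) (auto simp: fin)
  also have "\<dots> = (\<Sum>(i, j) \<in> {u..m} \<times> {v..n}. f i j)"
    by (rule sum.mono_neutral_right) (auto simp: fin intro!: zero)
  also have "\<dots> = (\<Sum>(i, j) \<in> {..m} \<times> {..n}. f i j)"
    by (rule sum.mono_neutral_left) (auto intro!: zero)
  finally show ?thesis
    by (simp add: sum.cartesian_product)
qed

theorem theorem1:
  fixes M :: "'a measure" and S T :: "'a \<Rightarrow> nat" and m n u v :: nat
  assumes "prob_space M"
    and "m > 0" and "n > 0"
    and "S \<in> measurable M (count_space UNIV)"
    and "T \<in> measurable M (count_space UNIV)"
    and "\<And>\<omega>. \<omega> \<in> space M \<Longrightarrow> S \<omega> \<in> {0..m}"
    and "\<And>\<omega>. \<omega> \<in> space M \<Longrightarrow> T \<omega> \<in> {0..n}"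
    and "u \<le> m" and "v \<le> n"
  shows "\<P>(\<omega> in M. S \<omega> = u \<and> T \<omega> = v) =
    (\<Sum>t = u + v..m + n. \<Sum>(i, j) \<in> {(i, j). i + j = t}.
       (-1) ^ (t - (u + v)) * real (i choose u) * real (j choose v) *
         binomial_moment M S T i j)"
proof -
  interpret prob_space M by fact
  let ?g = "\<lambda>i j. (-1) ^ (i + u) * (-1) ^ (j + v) * real (i choose u) * real (j choose v) *
    binomial_moment M S T i j"
  have bounds: "S \<omega> \<le> m" "T \<omega> \<le> n" if "\<omega> \<in> space M" for \<omega>
    using assms(6,7)[OF that] by auto
  \<comment> \<open>An antidiagonal may leave the rectangle through \<open>i > m\<close> or
    \<open>j > n\<close>, where the coefficients need not vanish but the moments do.\<close>
  have moment_zero: "binomial_moment M S T i j = 0" if "m < i \<or> n < j" for i j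
  proof -
    have "binomial_moment M S T i j = (\<integral>\<omega>. 0 \<partial>M)"
      unfolding binomial_moment_def
      using that by (intro Bochner_Integration.integral_cong refl) (fastforce dest: bounds)
    then show ?thesis by simp
  qed
  have "(\<Sum>t = u + v..m + n. \<Sum>(i, j) \<in> {(i, j). i + j = t}.
       (-1) ^ (t - (u + v)) * real (i choose u) * real (j choose v) * binomial_moment M S T i j) =
     (\<Sum>t = u + v..m + n. \<Sum>(i, j) \<in> {(i, j). i + j = t}. ?g i j)"
  proof (intro sum.cong refl)
    fix t p assume t: "t \<in> {u + v..m + n}" and p: "p \<in> {(i, j). i + j = t}"
    obtain i j where ij: "p = (i, j)" "i + j = t"
      using p by blast
    \<comment> \<open>Since \<open>t \<ge> u + v\<close>, the natural subtraction
      \<open>t - (u + v)\<close> is not truncated, and it has the same parity as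
      \<open>t + (u + v)\<close>.\<close>
    then obtain k where k: "i + j = u + v + k"
      using t le_Suc_ex by auto
    have "(-1::real) ^ (i + u) * (-1) ^ (j + v) = (-1) ^ (i + j + (u + v))"
      by (simp add: power_add)
    also have "\<dots> = (-1) ^ (i + j - (u + v))"
      unfolding k by (auto simp: minus_one_power_iff)
    finally show "(case p of (i, j) \<Rightarrow> (-1) ^ (t - (u + v)) * real (i choose u) * real (j choose v) *
        binomial_moment M S T i j) = (case p of (i, j) \<Rightarrow> ?g i j)"
      using ij by simp
  qed
  also have "\<dots> = (\<Sum>i\<le>m. \<Sum>j\<le>n. ?g i j)"
    \<comment> \<open>Below \<open>u\<close> or \<open>v\<close> the binomial coefficients vanish;
      above \<open>m\<close> or \<open>n\<close> the moments do.\<close>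
    by (rule sum_antidiagonals) (auto simp: not_le moment_zero)
  also have "\<dots> = \<P>(\<omega> in M. S \<omega> = u \<and> T \<omega> = v)"
    using assms(4,5) bounds by (rule prob_eq_sum_binomial_moment[symmetric])
  finally show ?thesis by (rule sym)
qed

end
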